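(* Let $f(z)=zh(z)\overline{g(z)}\in T_{Lh}$. Then $f$ maps the disk $\{z:|z|<3-2\sqrt{2}\}$ onto a starlike domain.
   Context: $U=\{z\in\mathbb{C}:|z|<1\}$; $\mathcal{H}(U)$ is the space of analytic functions on $U$; $B$ is the set of $a\in\mathcal{H}(U)$ with $|a|<1$ in $U$. A function $f$ on $U$ is a logharmonic mapping with respect to $a\in B$ if $\overline{\left(f_{\overline z}/f\right)}=a\,f_z/f$ in $U$ (where $f\neq 0$). An analytic function $\varphi$ in $U$ is typically real if $\varphi(z)$ is real whenever $z\in U$ is real and $\varphi(z)$ is nonreal for all other $z\in U$. $T_{Lh}$ is the class of logharmonic mappings $f(z)=zh(z)\overline{g(z)}$ in $U$ (with respect to some $a\in B$), where $h,g\in\mathcal{H}(U)$, $h(0)=1=g(0)$, $0\notin(hg)(U)$, such that $\varphi(z)=zh(z)g(z)$ is typically real in $U$. A domain is starlike here if it is starlike with respect to the origin. *)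

theory Defs
  imports "HOL-Complex_Analysis.Complex_Analysis"
begin

abbreviation unit_disc :: "complex set" where
  "unit_disc \<equiv> ball 0 1"

text \<open>
  The Wirtinger derivatives: with \<open>D\<close> the real derivative of \<open>f\<close> at \<open>z\<close>, the partial
  derivatives in \<open>x\<close> and \<open>y\<close> are \<open>D 1\<close> and \<open>D \<i>\<close>.
\<close>

definition deriv_z :: "(complex \<Rightarrow> complex) \<Rightarrow> complex \<Rightarrow> complex" where
  "deriv_z f z =
     (frechet_derivative f (at z) 1 - \<i> * frechet_derivative f (at z) \<i>) / 2"

definition deriv_zbar :: "(complex \<Rightarrow> complex) \<Rightarrow> complex \<Rightarrow> complex" where
  "deriv_zbar f z =
     (frechet_derivative f (at z) 1 + \<i> * frechet_derivative f (at z) \<i>) / 2"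

definition B :: "(complex \<Rightarrow> complex) set" where
  "B = {a. a holomorphic_on unit_disc \<and> (\<forall>z\<in>unit_disc. cmod (a z) < 1)}"

text \<open>
  Real differentiability is required explicitly because \<^const>\<open>frechet_derivative\<close> is
  unspecified at points where it fails.
\<close>

definition logharmonic :: "(complex \<Rightarrow> complex) \<Rightarrow> (complex \<Rightarrow> complex) \<Rightarrow> bool" where
  "logharmonic a f \<longleftrightarrow>
     (\<forall>z\<in>unit_disc. f differentiable (at z)) \<and>
     (\<forall>z\<in>unit_disc. f z \<noteq> 0 \<longrightarrow>
        cnj (deriv_zbar f z / f z) = a z * (deriv_z f z / f z))"

definition typically_real :: "(complex \<Rightarrow> complex) \<Rightarrow> bool" where
  "typically_real \<phi> \<longleftrightarrow>
     \<phi> holomorphic_on unit_disc \<and> (\<forall>z\<in>unit_disc. \<phi> z \<in> \<real> \<longleftrightarrow> z \<in> \<real>)"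

definition T_Lh :: "(complex \<Rightarrow> complex) set" where
  "T_Lh = {f. \<exists>h g.
     h holomorphic_on unit_disc \<and> g holomorphic_on unit_disc \<and>
     h 0 = 1 \<and> g 0 = 1 \<and>
     (\<forall>z\<in>unit_disc. h z * g z \<noteq> 0) \<and>
     (\<forall>z\<in>unit_disc. f z = z * h z * cnj (g z)) \<and>
     (\<exists>a\<in>B. logharmonic a f) \<and>
     typically_real (\<lambda>z. z * h z * g z)}"

text \<open>
  The library predicate \<^const>\<open>starlike\<close> allows an arbitrary centre; here it is the origin.
\<close>

definition starlike_domain :: "complex set \<Rightarrow> bool" where
  "starlike_domain D \<longleftrightarrow>
     open D \<and> connected D \<and> 0 \<in> D \<and> (\<forall>w\<in>D. closed_segment 0 w \<subseteq> D)"

end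

theory Submission
  imports Defs
begin

text \<open>
  Let \<open>f z = z * h z * cnj (g z)\<close>, and put \<open>s = z h'/h\<close> and \<open>t = z g'/g\<close>. The logharmonic
  equation reads \<open>t = a (1 + s)\<close>, and therefore \<open>a 0 = 0\<close> and, by the Schwarz lemma,
  \<open>\<bar>a z\<bar> \<le> \<bar>z\<bar>\<close>.

  The mapping differs by the positive factor \<open>\<bar>g\<bar>\<^sup>2\<close> from the analytic function \<open>\<psi> = z h / g\<close>.
  So \<open>arg f = arg \<psi>\<close>, and along a circle around \<open>0\<close> this argument grows at the rate \<open>Re (z \<psi>'/\<psi>)
  = Re (1 + s - t)\<close>. If this rate is positive on a disc, then each circle of the disc contains
  exactly one point (up to the period of the angle) where \<open>f\<close> has a given argument, this point
  moves continuously with the radius, and \<open>\<bar>f\<bar>\<close> tends to \<open>0\<close> along it as the radius does. By the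
  intermediate value theorem the image then contains the whole segment from \<open>0\<close> to each of its
  points (\<open>segment_subset_image_of_starlike_factor\<close>). Positivity also gives \<open>1 + s \<noteq> 0\<close>, so that
  the Jacobian of \<open>f\<close> is positive and the image is open (\<open>open_image_of_sense_preserving\<close>).

  Positivity of the rate comes from the typically real function \<open>\<phi> = z h g\<close>. With
  \<open>W = z \<phi>'/\<phi> = 1 + s + t = (1 + a) (1 + s)\<close> one has \<open>1 + s - t = (1 - a) / (1 + a) * W\<close>. As \<open>a\<close>
  is small near \<open>0\<close>, it is enough that \<open>W\<close> be close to \<open>1\<close> (\<open>Re_starlike_quotient_pos\<close>). For
  this, Rogosinski's theorem says that \<open>q = (1 - z\<^sup>2) \<phi> / z\<close> has nonnegative real part
  (\<open>typically_real_factor_Re_nonneg\<close>), and such a function has a small logarithmic derivative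
  near \<open>0\<close> (\<open>positive_real_part_log_deriv_bound\<close>), while \<open>W - 1\<close> is the sum of \<open>z q'/q\<close> and
  \<open>2 z\<^sup>2 / (1 - z\<^sup>2)\<close>. These estimates are crude, but they already cover all radii up to \<open>1/5\<close>,
  and \<open>3 - 2 * sqrt 2 < 1/5\<close>.
\<close>

section \<open>Starlike images from a monotone argument\<close>

text \<open>
  A strictly increasing function has at most one point on each level, and the sign of
  \<open>G r u - c\<close> at a point \<open>u\<close> on either side of the root survives small changes of \<open>r\<close>. This traps
  the root, so continuity in \<open>r\<close> for each fixed angle is enough.
\<close>

lemma continuous_level_curve:
  fixes G :: "'a::metric_space \<Rightarrow> real \<Rightarrow> real"
  assumes cont: "\<And>\<theta>. continuous_on S (\<lambda>r. G r \<theta>)"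
    and mono: "\<And>r. r \<in> S \<Longrightarrow> strict_mono (G r)"
    and root: "\<And>r. r \<in> S \<Longrightarrow> \<exists>\<theta>. G r \<theta> = c"
  obtains \<theta> where "continuous_on S \<theta>" "\<And>r. r \<in> S \<Longrightarrow> G r (\<theta> r) = c"
proof -
  obtain \<theta> where \<theta>: "\<And>r. r \<in> S \<Longrightarrow> G r (\<theta> r) = c"
    using root by metis
  have "(\<theta> \<longlongrightarrow> \<theta> x) (at x within S)" if x: "x \<in> S" for x
  proof -
    have lim: "((\<lambda>r. G r \<theta>) \<longlongrightarrow> G x \<theta>) (at x within S)" for \<theta>
      using cont x by (auto simp: continuous_on_def)
    show ?thesis
    proof (rule order_tendstoI)
      fix l assume "l < \<theta> x"
      then have "G x l < c"
        using mono[OF x] \<theta>[OF x] by (metis strict_monoD)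
      then have "\<forall>\<^sub>F y in at x within S. G y l < c"
        by (rule order_tendstoD(2)[OF lim])
      moreover have "\<forall>\<^sub>F y in at x within S. y \<in> S"
        by (simp add: eventually_at_filter)
      ultimately show "\<forall>\<^sub>F y in at x within S. l < \<theta> y"
        by eventually_elim (metis \<theta> mono strict_mono_less)
    next
      fix u assume "\<theta> x < u"
      then have "c < G x u"
        using mono[OF x] \<theta>[OF x] by (metis strict_monoD)
      then have "\<forall>\<^sub>F y in at x within S. c < G y u"
        by (rule order_tendstoD(1)[OF lim])
      moreover have "\<forall>\<^sub>F y in at x within S. y \<in> S"
        by (simp add: eventually_at_filter)
      ultimately show "\<forall>\<^sub>F y in at x within S. \<theta> y < u"
        by eventually_elim (metis \<theta> mono strict_mono_less)
    qed
  qed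
  then have "continuous_on S \<theta>"
    by (simp add: continuous_on_def)
  with \<theta> that show thesis by blast
qed

text \<open>
  The function is a continuous choice of the argument of \<open>z * exp (L z)\<close> along the circle of
  radius \<open>r\<close>. Its derivative in the angle is \<open>Re (1 + z * deriv L z)\<close>.
\<close>

lemma strict_mono_arg_on_circle:
  fixes L :: "complex \<Rightarrow> complex"
  assumes L: "L holomorphic_on ball 0 R"
    and pos: "\<And>z. z \<in> ball 0 R \<Longrightarrow> 0 < Re (1 + z * deriv L z)"
    and r: "0 \<le> r" "r < R"
  shows "strict_mono (\<lambda>\<theta>. \<theta> + Im (L (of_real r * cis \<theta>)))"
proof (rule strict_monoI)
  fix x y :: real assume "x < y"
  then show "x + Im (L (of_real r * cis x)) < y + Im (L (of_real r * cis y))"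
  proof (rule DERIV_pos_imp_increasing)
    fix \<theta> :: real
    define z where "z = of_real r * cis \<theta>"
    have z: "z \<in> ball 0 R"
      using r by (simp add: z_def norm_mult)
    have "((\<lambda>\<theta>. of_real r * cis \<theta>) has_vector_derivative \<i> * z) (at \<theta>)"
      unfolding z_def has_vector_derivative_def
      by (auto intro!: derivative_eq_intros simp: scaleR_conv_of_real algebra_simps)
    moreover have "(L has_field_derivative deriv L z) (at z)"
      using L z by (simp add: holomorphic_derivI)
    ultimately have "((L \<circ> (\<lambda>\<theta>. of_real r * cis \<theta>)) has_vector_derivative \<i> * z * deriv L z) (at \<theta>)"
      using field_vector_diff_chain_at z_def by blast
    then have "((\<lambda>\<theta>. \<theta> + Im (L (of_real r * cis \<theta>))) has_real_derivative 1 + Im (\<i> * z * deriv L z)) (at \<theta>)"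
      by (intro DERIV_add DERIV_ident has_field_derivative_Im) (simp add: o_def)
    moreover have "0 < 1 + Im (\<i> * z * deriv L z)"
      using pos[OF z] by (simp add: algebra_simps)
    ultimately show "\<exists>D. ((\<lambda>\<theta>. \<theta> + Im (L (of_real r * cis \<theta>))) has_real_derivative D) (at \<theta>) \<and> 0 < D"
      by blast
  qed
qed

text \<open>
  \<open>F\<close> is a real multiple of \<open>z * exp (L z)\<close>. The points where the latter has the same argument
  as at \<open>z1\<close> form a curve meeting each circle once. The curve joins \<open>0\<close> to \<open>z1\<close>, and \<open>F\<close> sends
  it into the line through \<open>0\<close> and \<open>F z1\<close>; a connected set in a line contains the segment between
  any two of its points.
\<close>

lemma segment_subset_image_of_starlike_factor:
  fixes L :: "complex \<Rightarrow> complex" and m :: "complex \<Rightarrow> real"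
  assumes L: "L holomorphic_on ball 0 R"
    and pos: "\<And>z. z \<in> ball 0 R \<Longrightarrow> 0 < Re (1 + z * deriv L z)"
    and m: "continuous_on (ball 0 R) m"
    and z1: "z1 \<in> ball 0 R"
  defines "F \<equiv> \<lambda>z. z * exp (L z) * of_real (m z)"
  shows "closed_segment 0 (F z1) \<subseteq> F ` ball 0 R"
proof
  fix w assume "w \<in> closed_segment 0 (F z1)"
  then obtain s where s: "0 \<le> s" "s \<le> 1" "w = of_real s * F z1"
    by (auto simp: closed_segment_def scaleR_conv_of_real)
  define \<rho> where "\<rho> = cmod z1"
  have \<rho>: "0 \<le> \<rho>" "\<rho> < R"
    using z1 by (auto simp: \<rho>_def)
  define G where "G = (\<lambda>r \<theta>. \<theta> + Im (L (of_real r * cis \<theta>)))"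
  define \<theta>1 where "\<theta>1 = Arg z1"
  have z1_polar: "z1 = of_real \<rho> * cis \<theta>1"
    by (metis rcis_def rcis_cmod_Arg \<rho>_def \<theta>1_def)
  define c where "c = G \<rho> \<theta>1"
  have in_ball: "of_real r * cis \<theta> \<in> ball 0 R" if "r \<in> {0..\<rho>}" for r \<theta>
    using that \<rho> by (simp add: norm_mult)
  have contL: "continuous_on (ball 0 R) L"
    using L by (rule holomorphic_on_imp_continuous_on)
  have L_circle: "continuous_on S (\<lambda>x. L (of_real (u x) * cis (v x)))"
    if "continuous_on S u" "continuous_on S v" "u ` S \<subseteq> {0..\<rho>}"
    for S :: "real set" and u v
    by (rule continuous_on_compose2[OF contL])
       (use that in_ball in \<open>auto intro!: continuous_intros\<close>)
  \<comment> \<open>\<open>G r \<theta>\<close> differs from \<open>\<theta>\<close> by a bounded amount, so it attains every value.\<close>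
  have root: "\<exists>\<theta>. G r \<theta> = c" if r: "r \<in> {0..\<rho>}" for r
  proof -
    have "compact (L ` cball 0 \<rho>)"
      by (rule compact_continuous_image[OF continuous_on_subset[OF contL]]) (use \<rho> in auto)
    then have "\<exists>M. \<forall>z\<in>cball 0 \<rho>. cmod (L z) \<le> M"
      using compact_imp_bounded[of "L ` cball 0 \<rho>"] by (simp add: bounded_iff)
    then obtain M where M: "\<And>z. cmod z \<le> \<rho> \<Longrightarrow> cmod (L z) \<le> M"
      by (metis mem_cball_0)
    have bd: "\<bar>Im (L (of_real r * cis \<theta>))\<bar> \<le> M" for \<theta>
    proof -
      have "cmod (L (of_real r * cis \<theta>)) \<le> M"
        using r by (intro M) (simp add: norm_mult)
      then show ?thesis using abs_Im_le_cmod order_trans by blast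
    qed
    have "M \<ge> 0" using bd[of 0] by linarith
    have "\<exists>\<theta>\<ge>c - M. \<theta> \<le> c + M \<and> G r \<theta> = c"
    proof (rule IVT')
      show "G r (c - M) \<le> c" "c \<le> G r (c + M)"
        using bd[of "c - M"] bd[of "c + M"] by (auto simp: G_def abs_le_iff)
      show "continuous_on {c - M..c + M} (G r)"
        unfolding G_def by (intro continuous_intros L_circle) (use r in auto)
    qed (use \<open>M \<ge> 0\<close> in auto)
    then show ?thesis by blast
  qed
  have mono: "strict_mono (G r)" if "r \<in> {0..\<rho>}" for r
    unfolding G_def by (rule strict_mono_arg_on_circle[OF L pos]) (use that \<rho> in auto)
  have contG: "continuous_on {0..\<rho>} (\<lambda>r. G r \<theta>)" for \<theta>
    unfolding G_def by (intro continuous_intros L_circle) auto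
  obtain \<theta> where \<theta>: "continuous_on {0..\<rho>} \<theta>" "\<And>r. r \<in> {0..\<rho>} \<Longrightarrow> G r (\<theta> r) = c"
    using continuous_level_curve[OF contG mono root] by metis
  define \<gamma> where "\<gamma> = (\<lambda>r. of_real r * cis (\<theta> r))"
  define H where "H = (\<lambda>r. r * exp (Re (L (\<gamma> r))) * m (\<gamma> r))"
  have \<gamma>_in: "\<gamma> r \<in> ball 0 R" if "r \<in> {0..\<rho>}" for r
    using in_ball[OF that] by (simp add: \<gamma>_def)
  have F\<gamma>: "F (\<gamma> r) = of_real (H r) * cis c" if "r \<in> {0..\<rho>}" for r
  proof -
    have "\<theta> r + Im (L (\<gamma> r)) = c"
      using \<theta>(2)[OF that] by (simp add: G_def \<gamma>_def)
    then have "cis c = cis (\<theta> r) * cis (Im (L (\<gamma> r)))"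
      by (simp add: cis_mult)
    moreover have "exp (L (\<gamma> r)) = of_real (exp (Re (L (\<gamma> r)))) * cis (Im (L (\<gamma> r)))"
      by (rule exp_eq_polar)
    ultimately show ?thesis
      unfolding F_def H_def by (simp add: \<gamma>_def)
  qed
  have "\<theta> \<rho> = \<theta>1"
    using \<theta>(2)[of \<rho>] \<rho> mono[of \<rho>] by (simp add: c_def strict_mono_eq)
  then have "\<gamma> \<rho> = z1"
    by (simp add: \<gamma>_def z1_polar)
  with F\<gamma>[of \<rho>] \<rho> have Fz1: "F z1 = of_real (H \<rho>) * cis c"
    by simp
  have cont\<gamma>: "continuous_on {0..\<rho>} \<gamma>"
    unfolding \<gamma>_def by (intro continuous_intros \<theta>(1))
  have "continuous_on {0..\<rho>} H"
    unfolding H_def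
    by (intro continuous_intros continuous_on_compose2[OF contL cont\<gamma>] continuous_on_compose2[OF m cont\<gamma>])
       (use \<gamma>_in in auto)
  then have "connected (H ` {0..\<rho>})"
    by (intro connected_continuous_image) auto
  moreover have "H 0 = 0" by (simp add: H_def)
  ultimately have "closed_segment 0 (H \<rho>) \<subseteq> H ` {0..\<rho>}"
    using \<rho> by (intro closed_segment_subset) (force simp: connected_convex_1)+
  moreover have "s * H \<rho> \<in> closed_segment 0 (H \<rho>)"
    using s by (auto simp: closed_segment_def)
  ultimately obtain r where r: "r \<in> {0..\<rho>}" "H r = s * H \<rho>"
    by (metis imageE subsetD)
  then have "F (\<gamma> r) = w"
    using F\<gamma>[OF r(1)] Fz1 s(3) by simp
  with \<gamma>_in[OF r(1)] show "w \<in> F ` ball 0 R" by blast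
qed

section \<open>Typically real functions and functions of positive real part\<close>

text \<open>
  \<open>Im (z * p z)\<close> has no zero in either half of the disc, so it has a constant sign on each half by
  connectedness. That sign is the sign of \<open>Im z\<close>, since \<open>z * p z\<close> behaves like \<open>z\<close> near \<open>0\<close>.
\<close>

lemma typically_real_Im_pos:
  assumes p: "p holomorphic_on unit_disc" "p 0 = 1"
    and real: "\<And>z. z \<in> unit_disc \<Longrightarrow> z * p z \<in> \<real> \<longleftrightarrow> z \<in> \<real>"
    and z: "z \<in> unit_disc"
  shows "0 \<le> Im z * Im (z * p z)"
proof -
  have contp: "continuous_on unit_disc p"
    using p(1) by (rule holomorphic_on_imp_continuous_on)
  \<comment> \<open>Both half-discs at once: \<open>\<sigma>\<close> is the sign of the half-plane.\<close>
  have half: "0 < \<sigma> * Im (w * p w)"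
    if \<sigma>: "\<sigma> = 1 \<or> \<sigma> = -1" and w: "w \<in> unit_disc" "0 < \<sigma> * Im w" for \<sigma> :: real and w
  proof (rule ccontr)
    assume neg: "\<not> 0 < \<sigma> * Im (w * p w)"
    define S where "S = unit_disc \<inter> {u. 0 < inner (Complex 0 \<sigma>) u}"
    have S_iff: "u \<in> S \<longleftrightarrow> u \<in> unit_disc \<and> 0 < \<sigma> * Im u" for u
      by (simp add: S_def inner_complex_def)
    have "convex S"
      unfolding S_def by (intro convex_Int convex_ball convex_halfspace_gt)
    then have conn: "connected ((\<lambda>u. \<sigma> * Im (u * p u)) ` S)"
      by (intro connected_continuous_image convex_connected continuous_intros
          continuous_on_subset[OF contp]) (auto simp: S_def)
    have "((\<lambda>t. Re (p (of_real t * Complex 0 \<sigma>))) \<longlongrightarrow> Re (p (of_real 0 * Complex 0 \<sigma>))) (at_right 0)"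
    proof -
      have "isCont p 0"
        using contp continuous_on_eq_continuous_at[of unit_disc p] by auto
      then have "isCont (\<lambda>t. p (of_real t * Complex 0 \<sigma>)) 0"
        by (intro isCont_o2[where g = p and f = "\<lambda>t. of_real t * Complex 0 \<sigma>"])
           (auto intro!: continuous_intros)
      then have "isCont (\<lambda>t. Re (p (of_real t * Complex 0 \<sigma>))) 0"
        by (rule continuous_Re)
      then show ?thesis
        by (simp add: isCont_def filterlim_at_split)
    qed
    then have "\<forall>\<^sub>F t in at_right 0. 0 < Re (p (of_real t * Complex 0 \<sigma>))"
      by (rule order_tendstoD(1)) (simp add: p)
    moreover have "\<forall>\<^sub>F t in at_right 0. t \<in> {0::real<..<1}"
      by (rule eventually_at_right_real) simp
    ultimately have "\<forall>\<^sub>F t in at_right 0. 0 < Re (p (of_real t * Complex 0 \<sigma>)) \<and> t \<in> {0<..<1}"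
      using eventually_conj by blast
    then obtain t where t: "0 < Re (p (of_real t * Complex 0 \<sigma>))" "0 < t" "t < 1"
      using eventually_happens'[OF trivial_limit_at_right_real] by fastforce
    define u where "u = of_real t * Complex 0 \<sigma>"
    have ss: "\<sigma> * \<sigma> = 1" using \<sigma> by auto
    have "cmod u = t"
      using t \<sigma> by (auto simp: u_def norm_mult cmod_def)
    then have uS: "u \<in> S"
      using t ss by (simp add: S_iff) (simp add: u_def mult.left_commute[of \<sigma>])
    have "\<sigma> * Im (u * p u) = \<sigma> * \<sigma> * (t * Re (p u))"
      by (simp add: u_def algebra_simps)
    also have "\<dots> = t * Re (p u)"
      by (simp add: ss)
    finally have "0 < \<sigma> * Im (u * p u)"
      using mult_pos_pos[OF t(2,1)] by (simp only: u_def)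
    moreover have "w \<in> S" using w S_iff by simp
    ultimately have "0 \<in> (\<lambda>u. \<sigma> * Im (u * p u)) ` S"
      using neg by (intro connectedD_interval[OF conn imageI imageI[OF uS], of w]) linarith+
    then obtain v where v: "v \<in> S" "0 = \<sigma> * Im (v * p v)"
      by (rule imageE)
    then have "Im (v * p v) = 0"
      using \<sigma> by (metis mult_eq_0_iff zero_neq_neg_one zero_neq_one)
    then have "v * p v \<in> \<real>"
      by (simp only: complex_is_Real_iff)
    then have "v \<in> \<real>"
      using real v(1) S_iff by blast
    with v(1) show False
      by (simp add: S_iff complex_is_Real_iff)
  qed
  show ?thesis
  proof (cases "Im z = 0")
    case False
    then consider "0 < Im z" | "0 < - Im z" by linarith
    then show ?thesis
    proof cases
      case 1
      then show ?thesis using half[of 1 z] z by simp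
    next
      case 2
      then show ?thesis using half[of "-1" z] z by (simp add: mult_nonpos_nonpos)
    qed
  qed simp
qed

text \<open>
  Rogosinski's theorem. On the unit circle \<open>(1 - u\<^sup>2) / u = cnj u - u = - 2 \<i> Im u\<close>, so that the
  real part of \<open>(1 - u\<^sup>2) * (\<phi> u / u)\<close> is \<open>2 * Im u * Im (\<phi> u)\<close>, which is nonnegative for
  \<open>\<phi> u = u * p u\<close>. The maximum principle carries this into the disc. As \<open>p\<close> need not extend to
  the circle, the argument is run for \<open>p (\<rho> * u)\<close> with \<open>\<rho> < 1\<close>, and \<open>\<rho>\<close> then tends to \<open>1\<close>.
\<close>

lemma typically_real_factor_Re_nonneg:
  assumes p: "p holomorphic_on unit_disc" "p 0 = 1"
    and real: "\<And>z. z \<in> unit_disc \<Longrightarrow> z * p z \<in> \<real> \<longleftrightarrow> z \<in> \<real>"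
    and z: "z \<in> unit_disc"
  shows "0 \<le> Re ((1 - z\<^sup>2) * p z)"
proof -
  have contp: "continuous_on unit_disc p"
    using p(1) by (rule holomorphic_on_imp_continuous_on)
  have scaled: "0 \<le> Re ((1 - z\<^sup>2) * p (of_real \<rho> * z))" if \<rho>: "0 < \<rho>" "\<rho> < 1" for \<rho> :: real
  proof -
    define F where "F = (\<lambda>z. - ((1 - z\<^sup>2) * p (of_real \<rho> * z)))"
    have in_disc: "of_real \<rho> * u \<in> unit_disc" if "cmod u \<le> 1" for u
    proof -
      have "\<rho> * cmod u \<le> \<rho> * 1" using that \<rho> by (intro mult_left_mono) auto
      then have "\<rho> * cmod u < 1" using \<rho> by linarith
      then show ?thesis using \<rho> by (simp add: norm_mult)
    qed
    have "Re (F z) \<le> 0"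
    proof (rule maximum_real_frontier[of F unit_disc])
      show "F holomorphic_on interior unit_disc"
        unfolding F_def interior_ball
        by (intro holomorphic_intros holomorphic_on_compose_gen[OF _ p(1), unfolded o_def])
           (use in_disc in auto)
      show "continuous_on (closure unit_disc) F"
        unfolding F_def
        by (intro continuous_intros continuous_on_compose2[OF contp])
           (use in_disc in auto)
      fix u :: complex assume "u \<in> frontier unit_disc"
      then have u: "cmod u = 1" by (simp add: frontier_ball)
      have uu: "u * cnj u = 1"
        using u by (simp add: complex_norm_square[symmetric])
      have "(1 - u\<^sup>2) * p (of_real \<rho> * u) = (cnj u - u) * (u * p (of_real \<rho> * u))"
        using uu by (simp add: algebra_simps power2_eq_square)
      also have "Re \<dots> = 2 * Im u * Im (u * p (of_real \<rho> * u))"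
        by (simp add: algebra_simps)
      finally have eq: "Re (F u) = - (2 * (Im u * Im (u * p (of_real \<rho> * u))))"
        unfolding F_def by simp
      have "0 \<le> Im (of_real \<rho> * u) * Im (of_real \<rho> * u * p (of_real \<rho> * u))"
        using typically_real_Im_pos[OF p real in_disc] u by simp
      also have "\<dots> = \<rho>\<^sup>2 * (Im u * Im (u * p (of_real \<rho> * u)))"
        by (simp add: algebra_simps power2_eq_square)
      finally have "0 \<le> Im u * Im (u * p (of_real \<rho> * u))"
        using \<rho> by (simp add: zero_le_mult_iff)
      then show "Re (F u) \<le> 0" using eq by simp
    qed (use z in auto)
    then show ?thesis by (simp add: F_def)
  qed
  have "isCont p z"
    using contp continuous_on_eq_continuous_at[of unit_disc p] z by auto
  then have "isCont (\<lambda>\<rho>. p (of_real \<rho> * z)) 1"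
    by (intro isCont_o2[where g = p and f = "\<lambda>\<rho>. of_real \<rho> * z"])
       (auto intro!: continuous_intros)
  then have "isCont (\<lambda>\<rho>. Re ((1 - z\<^sup>2) * p (of_real \<rho> * z))) 1"
    by (intro continuous_Re continuous_mult_left)
  then have "((\<lambda>\<rho>. Re ((1 - z\<^sup>2) * p (of_real \<rho> * z))) \<longlongrightarrow> Re ((1 - z\<^sup>2) * p (of_real 1 * z))) (at_left 1)"
    by (simp add: isCont_def filterlim_at_split)
  moreover have "\<forall>\<^sub>F \<rho> in at_left 1. 0 \<le> Re ((1 - z\<^sup>2) * p (of_real \<rho> * z))"
    using eventually_mono[OF eventually_at_left_real[of 0 "1::real"]] scaled by simp
  ultimately show ?thesis
    using tendsto_lowerbound[OF _ _ trivial_limit_at_left_real] by fastforce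
qed

text \<open>
  The Schwarz lemma under a non-strict bound, obtained by applying it to \<open>t * f\<close> for \<open>t < 1\<close>.
\<close>

lemma Schwarz_weak:
  assumes f: "f holomorphic_on ball 0 1" "f 0 = 0"
    and le: "\<And>z. cmod z < 1 \<Longrightarrow> cmod (f z) \<le> 1" and z: "cmod z < 1"
  shows "cmod (f z) \<le> cmod z"
proof (rule field_le_mult_one_interval)
  fix t :: real assume t: "0 < t" "t < 1"
  have "cmod (of_real t * f z) \<le> cmod z"
  proof (rule Schwarz_Lemma(1)[of "\<lambda>z. of_real t * f z"])
    show "cmod (of_real t * f w) < 1" if "cmod w < 1" for w
    proof -
      have "t * cmod (f w) \<le> t * 1" using le[OF that] t by (intro mult_left_mono) auto
      then have "t * cmod (f w) < 1" using t by linarith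
      then show ?thesis using t by (simp add: norm_mult)
    qed
  qed (use f z in \<open>auto intro!: holomorphic_intros\<close>)
  then show "t * cmod (f z) \<le> cmod z"
    using t by (simp add: norm_mult)
qed

text \<open>
  The Cayley transform \<open>\<omega> = (1 - q) / (1 + q)\<close> of \<open>q\<close> has modulus at most \<open>1\<close> and vanishes at
  \<open>0\<close>, and \<open>q'/q = - 2 \<omega>' / (1 - \<omega>\<^sup>2)\<close>. The Schwarz lemma controls the denominator, and Cauchy's
  estimate the numerator. (The Schwarz-Pick inequality would give the sharp bound
  \<open>2 \<bar>z\<bar> / (1 - \<bar>z\<bar>\<^sup>2)\<close>.)
\<close>

lemma positive_real_part_log_deriv_bound:
  assumes q: "q holomorphic_on unit_disc" "q 0 = 1"
    and pos: "\<And>z. z \<in> unit_disc \<Longrightarrow> 0 \<le> Re (q z)"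
    and z: "z \<in> unit_disc"
  shows "cmod (z * deriv q z / q z) \<le> 2 * cmod z / ((1 - cmod z) * (1 - (cmod z)\<^sup>2))"
proof -
  define \<omega> where "\<omega> = (\<lambda>z. (1 - q z) / (1 + q z))"
  have nz: "1 + q u \<noteq> 0" if "u \<in> unit_disc" for u
    using pos[OF that] by (auto simp: complex_eq_iff)
  have hol: "\<omega> holomorphic_on unit_disc"
    unfolding \<omega>_def by (intro holomorphic_intros q nz)
  have le1: "cmod (\<omega> u) \<le> 1" if "cmod u < 1" for u
  proof -
    have u: "u \<in> unit_disc" using that by simp
    have "(1 - Re (q u))\<^sup>2 \<le> (1 + Re (q u))\<^sup>2"
      using pos[OF u] by (simp add: power2_eq_square algebra_simps)
    then have "cmod (1 - q u) \<le> cmod (1 + q u)"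
      by (simp add: cmod_def)
    then show ?thesis
      using nz[OF u] by (simp add: \<omega>_def norm_divide divide_le_eq_1)
  qed
  have z1: "cmod z < 1" using z by simp
  then have z2: "(cmod z)\<^sup>2 < 1" by (simp add: power_less_one_iff)
  have "cmod (\<omega> z) \<le> cmod z"
    by (rule Schwarz_weak[OF hol _ le1 z1]) (use q in \<open>auto simp: \<omega>_def\<close>)
  then have "(cmod (\<omega> z))\<^sup>2 \<le> (cmod z)\<^sup>2"
    by (intro power_mono) auto
  moreover have "cmod 1 - cmod ((\<omega> z)\<^sup>2) \<le> cmod (1 - (\<omega> z)\<^sup>2)"
    by (rule norm_triangle_ineq2)
  ultimately have low: "1 - (cmod z)\<^sup>2 \<le> cmod (1 - (\<omega> z)\<^sup>2)"
    unfolding norm_power norm_one by linarith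
  \<comment> \<open>The circle of radius \<open>1 - \<bar>z\<bar>\<close> around \<open>z\<close> touches the boundary, so slightly smaller ones
     serve for Cauchy's estimate.\<close>
  have "cmod (deriv \<omega> z) * (1 - cmod z) \<le> 1"
  proof (rule field_le_mult_one_interval)
    fix \<tau> :: real assume \<tau>: "0 < \<tau>" "\<tau> < 1"
    define r where "r = \<tau> * (1 - cmod z)"
    have r: "0 < r" "r < 1 - cmod z"
      using \<tau> z1 by (auto simp: r_def)
    have sub: "cball z r \<subseteq> unit_disc"
    proof
      fix u assume "u \<in> cball z r"
      then have "cmod (u - z) \<le> r" by (simp add: dist_norm norm_minus_commute)
      then show "u \<in> unit_disc"
        using r norm_triangle_ineq[of "u - z" z] by simp
    qed
    have "cmod ((deriv ^^ 1) \<omega> z) \<le> fact 1 * 1 / r ^ 1"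
    proof (rule Cauchy_inequality)
      show "\<omega> holomorphic_on ball z r"
        using hol sub by (meson ball_subset_cball holomorphic_on_subset order_trans)
      show "continuous_on (cball z r) \<omega>"
        using hol sub by (meson continuous_on_subset holomorphic_on_imp_continuous_on)
      fix x assume "cmod (z - x) = r"
      then have "x \<in> cball z r" by (simp add: dist_norm)
      then have "x \<in> unit_disc" using sub by blast
      then show "cmod (\<omega> x) \<le> 1" using le1 by simp
    qed (rule r)
    then have "cmod (deriv \<omega> z) * r \<le> 1"
      using r by (simp add: pos_le_divide_eq)
    then show "\<tau> * (cmod (deriv \<omega> z) * (1 - cmod z)) \<le> 1"
      by (simp add: r_def mult.left_commute)
  qed
  then have d: "cmod (deriv \<omega> z) \<le> 1 / (1 - cmod z)"
    using z1 by (simp add: pos_le_divide_eq)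
  have "(q has_field_derivative deriv q z) (at z)"
    using q z by (simp add: holomorphic_derivI)
  then have "(\<omega> has_field_derivative - 2 * deriv q z / (1 + q z)\<^sup>2) (at z)"
    unfolding \<omega>_def using nz[OF z]
    by (auto intro!: derivative_eq_intros simp: power2_eq_square field_simps)
  then have d\<omega>: "deriv \<omega> z = - 2 * deriv q z / (1 + q z)\<^sup>2"
    by (rule DERIV_imp_deriv)
  have "1 - (\<omega> z)\<^sup>2 = 4 * q z / (1 + q z)\<^sup>2"
    using nz[OF z] by (simp add: \<omega>_def power_divide divide_simps) (simp add: power2_eq_square algebra_simps)
  with d\<omega> have "deriv q z / q z = - 2 * deriv \<omega> z / (1 - (\<omega> z)\<^sup>2)"
    using nz[OF z] by simp
  then have "cmod (z * deriv q z / q z) = cmod z * (2 * cmod (deriv \<omega> z) / cmod (1 - (\<omega> z)\<^sup>2))"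
    by (metis norm_mult norm_divide norm_minus_cancel norm_numeral times_divide_eq_right)
  also have "\<dots> \<le> cmod z * (2 * (1 / (1 - cmod z)) / (1 - (cmod z)\<^sup>2))"
    using d low z1 z2 by (intro mult_left_mono frac_le) auto
  finally show ?thesis
    by (simp only: times_divide_eq_right divide_divide_eq_left mult_1_right mult.commute[of "cmod z" 2])
qed

section \<open>Logharmonic mappings\<close>

lemma has_derivative_mult_cnj:
  assumes "k holomorphic_on S" "g holomorphic_on S" "open S" "z \<in> S"
    and f: "\<And>z. z \<in> S \<Longrightarrow> f z = k z * cnj (g z)"
  shows "(f has_derivative (\<lambda>v. deriv k z * cnj (g z) * v + k z * cnj (deriv g z) * cnj v)) (at z)"
proof -
  have k: "(k has_derivative (*) (deriv k z)) (at z)" and g: "(g has_derivative (*) (deriv g z)) (at z)"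
    using assms by (auto intro!: has_field_derivative_imp_has_derivative holomorphic_derivI)
  have "((\<lambda>z. k z * cnj (g z)) has_derivative
      (\<lambda>v. deriv k z * cnj (g z) * v + k z * cnj (deriv g z) * cnj v)) (at z)"
    by (auto intro!: derivative_eq_intros k g simp: algebra_simps)
  then show ?thesis
    by (rule has_derivative_transform_within_open[OF _ \<open>open S\<close> \<open>z \<in> S\<close>]) (simp add: f)
qed

text \<open>
  For \<open>f = k * cnj g\<close> the two Wirtinger derivatives are \<open>k' * cnj g\<close> and \<open>k * cnj g'\<close>, so the
  logharmonic equation becomes a relation between the analytic functions \<open>k\<close> and \<open>g\<close>.
\<close>

lemma logharmonic_mult_cnj:
  assumes k: "k holomorphic_on unit_disc" and g: "g holomorphic_on unit_disc"
    and f: "\<And>z. z \<in> unit_disc \<Longrightarrow> f z = k z * cnj (g z)"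
    and lh: "logharmonic a f" and z: "z \<in> unit_disc" and nz: "k z \<noteq> 0" "g z \<noteq> 0"
  shows "deriv g z / g z = a z * (deriv k z / k z)"
proof -
  have "frechet_derivative f (at z) = (\<lambda>v. deriv k z * cnj (g z) * v + k z * cnj (deriv g z) * cnj v)"
    by (rule frechet_derivative_at[symmetric])
       (rule has_derivative_mult_cnj[OF k g _ z f], auto)
  then have "deriv_z f z = deriv k z * cnj (g z)" "deriv_zbar f z = k z * cnj (deriv g z)"
    by (simp_all add: deriv_z_def deriv_zbar_def algebra_simps)
  moreover have "cnj (deriv_zbar f z / f z) = a z * (deriv_z f z / f z)"
    using lh z nz f[OF z] unfolding logharmonic_def by fastforce
  ultimately show ?thesis
    using nz f[OF z] by simp
qed

text \<open>
  With \<open>W = 1 + s + t\<close> the relation gives \<open>1 + s - t = (1 - A) / (1 + A) * W\<close>. After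
  multiplication by \<open>\<bar>1 + A\<bar>\<^sup>2\<close> its real part is
  \<open>(1 - \<bar>A\<bar>\<^sup>2) * Re W + 2 * Im A * Im W\<close>, and \<open>W\<close> lies within \<open>c\<close> of \<open>1\<close>.
\<close>

lemma Re_starlike_quotient_pos:
  fixes A s t :: complex
  assumes t: "t = A * (1 + s)" and A: "cmod A \<le> 1" and st: "cmod (s + t) \<le> c"
    and c: "2 * cmod A * c < (1 - (cmod A)\<^sup>2) * (1 - c)"
  shows "0 < Re (1 + s - t)"
proof -
  define W where "W = 1 + s + t"
  have "\<bar>Re (s + t)\<bar> \<le> c" "\<bar>Im (s + t)\<bar> \<le> c"
    using st abs_Re_le_cmod[of "s + t"] abs_Im_le_cmod[of "s + t"] by linarith+
  then have W: "1 - c \<le> Re W" "\<bar>Im W\<bar> \<le> c"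
    unfolding W_def plus_complex.sel one_complex.sel by linarith+
  have "(cmod A)\<^sup>2 \<le> 1"
    using A by (simp add: power_le_one)
  then have "(1 - (cmod A)\<^sup>2) * (1 - c) \<le> (1 - (cmod A)\<^sup>2) * Re W"
    using W by (intro mult_left_mono) auto
  moreover have "\<bar>2 * Im A * Im W\<bar> \<le> 2 * cmod A * c"
    unfolding abs_mult using abs_Im_le_cmod[of A] W by (intro mult_mono) auto
  ultimately have "0 < (1 - (cmod A)\<^sup>2) * Re W + 2 * Im A * Im W"
    using c by linarith
  also have "\<dots> = Re ((1 - A) * (1 + cnj A) * W)"
    unfolding cmod_power2 by (simp add: power2_eq_square algebra_simps)
  also have "(1 - A) * (1 + cnj A) * W = (1 + s - t) * ((1 + A) * cnj (1 + A))"
    by (simp add: W_def t algebra_simps)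
  also have "(1 + A) * cnj (1 + A) = of_real ((cmod (1 + A))\<^sup>2)"
    by (rule complex_norm_square[symmetric])
  also have "Re ((1 + s - t) * of_real ((cmod (1 + A))\<^sup>2)) = Re (1 + s - t) * (cmod (1 + A))\<^sup>2"
    by simp
  finally show ?thesis
    by (simp add: zero_less_mult_iff)
qed

text \<open>
  The hypothesis says that \<open>\<bar>f\<^sub>z\<bar>\<close> exceeds the modulus of the derivative in \<open>cnj z\<close>, that is, the
  Jacobian is positive. The real derivative is then invertible at each point, and openness
  follows as in the inverse function theorem.
\<close>

lemma open_image_of_sense_preserving:
  assumes k: "k holomorphic_on S" and g: "g holomorphic_on S" and S: "open S"
    and jac: "\<And>z. z \<in> S \<Longrightarrow> cmod (k z * deriv g z) < cmod (deriv k z * g z)"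
  shows "open ((\<lambda>z. k z * cnj (g z)) ` S)"
proof -
  define F where "F = (\<lambda>z. k z * cnj (g z))"
  have "F z \<in> interior (F ` S)" if z: "z \<in> S" for z
  proof -
    define D where "D = (\<lambda>v. deriv k z * cnj (g z) * v + k z * cnj (deriv g z) * cnj v)"
    have D: "(F has_derivative D) (at z)"
      unfolding D_def by (rule has_derivative_mult_cnj[OF k g S z]) (simp add: F_def)
    have lin: "linear D"
      using D has_derivative_linear by blast
    \<comment> \<open>The two terms of \<open>D v\<close> have different moduli unless \<open>v = 0\<close>.\<close>
    have "v = 0" if "D v = 0" for v
    proof (rule ccontr)
      assume "v \<noteq> 0"
      have "deriv k z * cnj (g z) * v = - (k z * cnj (deriv g z) * cnj v)"
        using that unfolding D_def by (simp add: add_eq_0_iff2)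
      then have "cmod (deriv k z * g z) * cmod v = cmod (k z * deriv g z) * cmod v"
        by (metis norm_mult norm_minus_cancel complex_mod_cnj)
      then show False using jac[OF z] \<open>v \<noteq> 0\<close> by simp
    qed
    then have "inj D"
      using lin linear_injective_0 by blast
    then have "surj D"
      using lin by (simp add: linear_injective_imp_surjective)
    then obtain D' where D': "linear D'" "D \<circ> D' = id"
      using lin linear_surjective_right_inverse by blast
    have "continuous_on S F"
      unfolding F_def using k g by (intro continuous_intros holomorphic_on_imp_continuous_on)
    then show ?thesis
      using sussmann_open_mapping[OF S _ z D _ D'(2), of S] D'(1) S z
      by (simp add: linear_conv_bounded_linear interior_open)
  qed
  then show ?thesis
    unfolding F_def[symmetric] by (metis image_subsetI interior_subset open_interior subset_antisym)
qed

section \<open>The starlikeness radius\<close>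

text \<open>
  The bounds for \<open>\<bar>z\<bar> \<le> 1/5\<close> are \<open>25/48\<close> for \<open>z q'/q\<close> and \<open>1/12\<close> for \<open>2 z\<^sup>2 / (1 - z\<^sup>2)\<close>. Hence
  \<open>W = 1 + s + t\<close> lies within \<open>29/48\<close> of \<open>1\<close>, which is close enough to make \<open>Re (1 + s - t)\<close>
  positive when \<open>\<bar>a z\<bar> \<le> 1/5\<close>.
\<close>

lemma T_Lh_imp_starlike_domain:
  assumes f: "f \<in> T_Lh" and R: "0 < R" "R \<le> 1/5"
  shows "starlike_domain (f ` ball 0 R)"
proof -
  obtain h g a where h: "h holomorphic_on unit_disc" "h 0 = 1"
    and g: "g holomorphic_on unit_disc" "g 0 = 1"
    and nz: "\<And>z. z \<in> unit_disc \<Longrightarrow> h z \<noteq> 0" "\<And>z. z \<in> unit_disc \<Longrightarrow> g z \<noteq> 0"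
    and feq: "\<And>z. z \<in> unit_disc \<Longrightarrow> f z = z * h z * cnj (g z)"
    and aB: "a \<in> B" and lh: "logharmonic a f"
    and tr: "typically_real (\<lambda>z. z * h z * g z)"
    using f unfolding T_Lh_def by auto
  have a: "a holomorphic_on unit_disc" "\<And>z. cmod z < 1 \<Longrightarrow> cmod (a z) < 1"
    using aB by (auto simp: B_def)
  define p where "p = (\<lambda>z. h z * g z)"
  define q where "q = (\<lambda>z. (1 - z\<^sup>2) * p z)"
  define k where "k = (\<lambda>z. z * h z)"
  define s where "s = (\<lambda>z. z * deriv h z / h z)"
  define t where "t = (\<lambda>z. z * deriv g z / g z)"
  have hd: "(h has_field_derivative deriv h z) (at z)"
    and gd: "(g has_field_derivative deriv g z) (at z)" if "z \<in> unit_disc" for z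
    using that h g by (auto intro!: holomorphic_derivI)
  have k: "k holomorphic_on unit_disc"
    unfolding k_def by (intro holomorphic_intros h)
  have kd: "deriv k z = h z * (1 + s z)" if z: "z \<in> unit_disc" for z
    unfolding k_def s_def
    by (rule DERIV_imp_deriv)
       (use nz(1)[OF z] in \<open>auto intro!: derivative_eq_intros hd[OF z] simp: field_simps\<close>)
  have t_eq': "t z = a z * (1 + s z)" if z: "z \<in> unit_disc" "z \<noteq> 0" for z
  proof -
    have "deriv g z / g z = a z * (deriv k z / k z)"
      by (rule logharmonic_mult_cnj[OF k g(1) _ lh z(1)]) (use z nz feq in \<open>auto simp: k_def\<close>)
    then have "t z = z * (a z * (deriv k z / k z))"
      by (simp add: t_def flip: times_divide_eq_right)
    then show ?thesis
      using z nz(1)[OF z(1)] kd[OF z(1)] by (simp add: k_def)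
  qed
  \<comment> \<open>The logharmonic equation is void at the zero of \<open>f\<close>; its analytic form extends by continuity.\<close>
  have a0: "a 0 = 0"
  proof -
    define d where "d = (\<lambda>z. t z - a z * (1 + s z))"
    have "d holomorphic_on unit_disc"
      unfolding d_def s_def t_def by (intro holomorphic_intros h g a nz) auto
    then have "isCont d 0"
      using holomorphic_on_imp_continuous_on continuous_on_eq_continuous_at[of unit_disc d] by auto
    then have "d \<midarrow>0\<rightarrow> d 0" by (simp add: isCont_def)
    moreover have "d \<midarrow>0\<rightarrow> 0"
    proof (rule tendsto_eventually)
      have "\<forall>\<^sub>F z in at 0. z \<in> unit_disc - {0}"
        by (rule eventually_at_in_open) auto
      then show "\<forall>\<^sub>F z in at 0. d z = 0"
        by eventually_elim (simp add: d_def t_eq')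
    qed
    ultimately have "d 0 = 0" by (rule LIM_unique)
    then show ?thesis by (simp add: d_def s_def t_def)
  qed
  have t_eq: "t z = a z * (1 + s z)" if "z \<in> unit_disc" for z
    using t_eq'[OF that] a0 by (cases "z = 0") (auto simp: t_def)
  have p: "p holomorphic_on unit_disc" "p 0 = 1"
    unfolding p_def by (intro holomorphic_intros h g) (simp add: h g)
  have q: "q holomorphic_on unit_disc" "q 0 = 1"
    unfolding q_def by (intro holomorphic_intros p) (simp add: p)
  have qpos: "0 \<le> Re (q z)" if "z \<in> unit_disc" for z
    unfolding q_def using tr
    by (intro typically_real_factor_Re_nonneg p that) (auto simp: typically_real_def p_def mult.assoc)
  have pos: "0 < Re (1 + s z - t z)" if z: "z \<in> ball 0 R" for z
  proof (rule Re_starlike_quotient_pos)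
    have z5: "cmod z \<le> 1/5" and zd: "z \<in> unit_disc" using z R by auto
    show "t z = a z * (1 + s z)" by (rule t_eq[OF zd])
    have a5: "cmod (a z) \<le> 1/5"
      using Schwarz_Lemma(1)[OF a(1) a0 a(2), of z] z5 zd by simp
    then show "cmod (a z) \<le> 1" by simp
    have "(cmod (a z))\<^sup>2 \<le> 1/25"
      using power_mono[OF a5, of 2] by (simp add: power_divide)
    then show "2 * cmod (a z) * (29/48) < (1 - (cmod (a z))\<^sup>2) * (1 - 29/48)"
      using a5 by simp
    have z2: "cmod (z\<^sup>2) \<le> 1/25"
      using power_mono[OF z5, of 2] by (simp add: norm_power power_divide)
    have "cmod 1 - cmod (z\<^sup>2) \<le> cmod (1 - z\<^sup>2)"
      by (rule norm_triangle_ineq2)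
    then have low: "24/25 \<le> cmod (1 - z\<^sup>2)" using z2 by simp
    then have nz2: "1 - z\<^sup>2 \<noteq> 0" by auto
    have "(q has_field_derivative (1 - z\<^sup>2) * (deriv h z * g z + h z * deriv g z) - 2 * z * (h z * g z)) (at z)"
      unfolding q_def p_def
      by (auto intro!: derivative_eq_intros hd[OF zd] gd[OF zd] simp: algebra_simps)
    then have "deriv q z = (1 - z\<^sup>2) * (deriv h z * g z + h z * deriv g z) - 2 * z * (h z * g z)"
      by (rule DERIV_imp_deriv)
    also have "\<dots> = q z * (deriv h z / h z + deriv g z / g z - 2 * z / (1 - z\<^sup>2))"
      using nz2 nz[OF zd] by (simp add: q_def p_def field_simps)
    finally have "deriv q z / q z = deriv h z / h z + deriv g z / g z - 2 * z / (1 - z\<^sup>2)"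
      using nz2 nz[OF zd] by (simp add: q_def p_def)
    then have "z * (deriv q z / q z) = z * (deriv h z / h z + deriv g z / g z - 2 * z / (1 - z\<^sup>2))"
      by (rule arg_cong)
    then have "s z + t z = z * deriv q z / q z + 2 * z\<^sup>2 / (1 - z\<^sup>2)"
      by (simp add: s_def t_def right_diff_distrib distrib_left power2_eq_square)
    also have "cmod \<dots> \<le> cmod (z * deriv q z / q z) + cmod (2 * z\<^sup>2 / (1 - z\<^sup>2))"
      by (rule norm_triangle_ineq)
    also have "cmod (2 * z\<^sup>2 / (1 - z\<^sup>2)) = 2 * cmod (z\<^sup>2) / cmod (1 - z\<^sup>2)"
      by (simp add: norm_divide norm_mult)
    also have "\<dots> \<le> 2 * (1/25) / (24/25)"
      using z2 low by (intro frac_le) auto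
    also have "cmod (z * deriv q z / q z) \<le> 2 * cmod z / ((1 - cmod z) * (1 - (cmod z)\<^sup>2))"
      by (rule positive_real_part_log_deriv_bound[OF q qpos zd])
    also have "\<dots> \<le> 2 * (1/5) / ((1 - 1/5) * (1 - 1/25))"
      using z5 z2 by (intro frac_le mult_mono) (auto simp: norm_power)
    finally show "cmod (s z + t z) \<le> 29/48" by simp
  qed
  have subR: "ball 0 R \<subseteq> unit_disc" using R by auto
  \<comment> \<open>\<open>L\<close> is a logarithm of \<open>\<psi> / z = h / g\<close>.\<close>
  obtain L where L: "L holomorphic_on unit_disc" "\<And>z. z \<in> unit_disc \<Longrightarrow> exp (L z) = h z / g z"
  proof (rule holomorphic_logarithm_exists[of unit_disc "\<lambda>z. h z / g z" 0])
    show "(\<lambda>z. h z / g z) holomorphic_on unit_disc"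
      by (intro holomorphic_on_divide h(1) g(1) nz(2))
  qed (use nz in auto)
  have Ld: "1 + z * deriv L z = 1 + s z - t z" if z: "z \<in> unit_disc" for z
  proof -
    have "((\<lambda>z. exp (L z)) has_field_derivative exp (L z) * deriv L z) (at z)"
      using L(1) z by (auto intro!: derivative_eq_intros holomorphic_derivI)
    then have "((\<lambda>z. h z / g z) has_field_derivative exp (L z) * deriv L z) (at z)"
      by (rule has_field_derivative_transform_within_open[OF _ open_ball z]) (simp add: L(2))
    moreover have "((\<lambda>z. h z / g z) has_field_derivative
        (deriv h z * g z - h z * deriv g z) / (g z * g z)) (at z)"
      using DERIV_divide[OF hd[OF z] gd[OF z]] nz(2)[OF z] by simp
    ultimately have "exp (L z) * deriv L z = (deriv h z * g z - h z * deriv g z) / (g z * g z)"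
      by (rule DERIV_unique)
    then have "deriv L z = deriv h z / h z - deriv g z / g z"
      using nz[OF z] by (simp add: L(2)[OF z] field_simps)
    then have "z * deriv L z = z * (deriv h z / h z - deriv g z / g z)" by simp
    then show ?thesis by (simp add: s_def t_def right_diff_distrib)
  qed
  define m where "m = (\<lambda>z. (cmod (g z))\<^sup>2)"
  have f_polar: "z * exp (L z) * of_real (m z) = f z" if z: "z \<in> unit_disc" for z
  proof -
    have "of_real (m z) = g z * cnj (g z)"
      unfolding m_def by (rule complex_norm_square)
    then show ?thesis
      using nz(2)[OF z] by (simp add: L(2)[OF z] feq[OF z])
  qed
  have contf: "continuous_on (ball 0 R) f"
  proof -
    have "continuous_on (ball 0 R) (\<lambda>z. z * h z * cnj (g z))"
      using h g subR
      by (intro continuous_intros) (meson continuous_on_subset holomorphic_on_imp_continuous_on)+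
    then show ?thesis
      by (rule continuous_on_eq) (use feq subR in auto)
  qed
  have "open ((\<lambda>z. k z * cnj (g z)) ` ball 0 R)"
  proof (rule open_image_of_sense_preserving)
    fix z :: complex assume z: "z \<in> ball 0 R"
    then have zd: "z \<in> unit_disc" using subR by auto
    have "k z * deriv g z = h z * g z * t z"
      using nz[OF zd] by (simp add: k_def t_def)
    also have "\<dots> = a z * (deriv k z * g z)"
      by (simp add: t_eq[OF zd] kd[OF zd])
    finally have eq: "cmod (k z * deriv g z) = cmod (a z) * cmod (deriv k z * g z)"
      by (simp add: norm_mult)
    have "1 + s z - t z = (1 - a z) * (1 + s z)"
      by (simp add: t_eq[OF zd] algebra_simps)
    then have "1 + s z \<noteq> 0"
      using pos[OF z] by (metis less_irrefl mult_zero_right zero_complex.sel(1))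
    then have "0 < cmod (deriv k z * g z)"
      using nz[OF zd] by (simp add: kd[OF zd])
    then show "cmod (k z * deriv g z) < cmod (deriv k z * g z)"
      using eq a(2)[of z] zd by simp
  qed (use k g subR in \<open>auto intro: holomorphic_on_subset\<close>)
  also have "(\<lambda>z. k z * cnj (g z)) ` ball 0 R = f ` ball 0 R"
    by (rule image_cong) (use feq subR in \<open>auto simp: k_def\<close>)
  finally have "open (f ` ball 0 R)" .
  moreover have "connected (f ` ball 0 R)"
    by (intro connected_continuous_image contf connected_ball)
  moreover have "0 \<in> f ` ball 0 R"
    using feq[of 0] R by (auto intro!: image_eqI[of _ _ 0])
  moreover have "closed_segment 0 (f z) \<subseteq> f ` ball 0 R" if z: "z \<in> ball 0 R" for z
  proof -
    have "closed_segment 0 (z * exp (L z) * of_real (m z))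
        \<subseteq> (\<lambda>z. z * exp (L z) * of_real (m z)) ` ball 0 R"
    proof (rule segment_subset_image_of_starlike_factor[OF _ _ _ z])
      show "L holomorphic_on ball 0 R"
        using L(1) subR by (rule holomorphic_on_subset)
      show "0 < Re (1 + u * deriv L u)" if "u \<in> ball 0 R" for u
        unfolding Ld[OF subsetD[OF subR that]] by (rule pos[OF that])
      show "continuous_on (ball 0 R) m"
        unfolding m_def using g subR
        by (intro continuous_intros) (meson continuous_on_subset holomorphic_on_imp_continuous_on)
    qed
    also have "(\<lambda>z. z * exp (L z) * of_real (m z)) ` ball 0 R = f ` ball 0 R"
      by (rule image_cong) (use f_polar subR in auto)
    finally show ?thesis
      unfolding f_polar[OF subsetD[OF subR z]] .
  qed
  ultimately show ?thesis
    by (auto simp: starlike_domain_def)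
qed

theorem theorem2:
  fixes f :: "complex \<Rightarrow> complex"
  assumes "f \<in> T_Lh"
  shows "starlike_domain (f ` ball 0 (3 - 2 * sqrt 2))"
proof (rule T_Lh_imp_starlike_domain[OF assms])
  have "7/5 < sqrt 2" "sqrt 2 < 3/2"
    by (rule real_less_rsqrt, simp add: power2_eq_square)
       (rule real_less_lsqrt, simp_all add: power2_eq_square)
  then show "0 < 3 - 2 * sqrt 2" "3 - 2 * sqrt 2 \<le> 1/5"
    by linarith+
qed

end
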